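(* For any fixed dimension $d\ge 1$, the functions $n\mapsto M_d(n,n)$, $n\mapsto E_d(n)$ and $n\mapsto W_d(n)$ are pairwise asymptotically equivalent, where two functions $f,g:\mathbf{N}\to\mathbf{N}$ are called asymptotically equivalent if there exist constants $c_1,c_2>0$ such that $c_1f(n)\leq g(n)\leq c_2f(n)$ for all $n\geq 2$.
   Context: A set of points in $\mathbf{R}^d$ is convexly independent if it is the vertex set of its convex hull, i.e. no point of it lies in the convex hull of the others. $E_d(n)$: for a finite set $P\subset\mathbf{R}^d$, let $E(P)$ be the maximum number of (unordered) pairs of distinct points of $P$ such that the midpoints of these pairs are convexly independent (distinct pairs selected having distinct midpoints); $E_d(n)=\max\{E(P): P\subset\mathbf{R}^d, |P|=n\}$. $M_d(m,n)$: the maximum size of a convexly independent subset of the Minkowski sum $P+Q=\{p+q: p\in P,q\in Q\}$, the maximum being over all sets $P$ of $m$ points and $Q$ of $n$ points in $\mathbf{R}^d$. $W_d(n)$: the maximum number of pairwise nonparallel segments of unit length (measured in the norm) with both endpoints in a set of $n$ points, the maximum being over all sets of $n$ points in $\mathbf{R}^d$ and all strictly convex norms on $\mathbf{R}^d$ (a norm is strictly convex if its unit sphere contains no nondegenerate line segment). *)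

theory Defs
  imports "HOL-Analysis.Analysis" "HOL-Library.Set_Algebras"
begin

definition convexly_independent :: "'a::real_vector set \<Rightarrow> bool" where
  "convexly_independent S \<longleftrightarrow> (\<forall>x\<in>S. x \<notin> convex hull (S - {x}))"

(* An unordered pair of distinct points of P is a two-element subset of P. *)
definition pairs :: "'a set \<Rightarrow> 'a set set" where
  "pairs P = {e. e \<subseteq> P \<and> card e = 2}"

(* Only meant for two-element sets; see the lemma below. *)
definition pair_midpoint :: "'a::real_vector set \<Rightarrow> 'a" where
  "pair_midpoint e = (1/2) *\<^sub>R (\<Sum>x\<in>e. x)"

lemma pair_midpoint_doubleton: "x \<noteq> y \<Longrightarrow> pair_midpoint {x, y} = midpoint x y"
  by (simp add: pair_midpoint_def midpoint_def)

definition E_of :: "'a::real_vector set \<Rightarrow> nat" where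
  "E_of P = Max {card S | S. S \<subseteq> pairs P \<and> inj_on pair_midpoint S
                           \<and> convexly_independent (pair_midpoint ` S)}"

(* In the next three functions the dimension d is CARD('d), passed through the
   type argument; every d >= 1 arises in this way. Finiteness is explicit since
   infinite sets have card 0. *)
definition E_fun :: "'d::finite itself \<Rightarrow> nat \<Rightarrow> nat" where
  "E_fun _ n = Max {E_of P | P :: (real ^ 'd) set. finite P \<and> card P = n}"

(* P + Q is the Minkowski sum of Set_Algebras. *)
definition M_fun :: "'d::finite itself \<Rightarrow> nat \<Rightarrow> nat \<Rightarrow> nat" where
  "M_fun _ m n = Max {card S | S P Q :: (real ^ 'd) set.
      finite P \<and> card P = m \<and> finite Q \<and> card Q = n \<and>
      S \<subseteq> P + Q \<and> convexly_independent S}"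

(* The statement ranges over all norms, so the norm is a predicate on functions
   rather than the Euclidean norm of the type. *)
definition is_norm :: "('a::real_vector \<Rightarrow> real) \<Rightarrow> bool" where
  "is_norm N \<longleftrightarrow>
     (\<forall>x. N x \<ge> 0) \<and> (\<forall>x. N x = 0 \<longleftrightarrow> x = 0) \<and>
     (\<forall>c x. N (c *\<^sub>R x) = \<bar>c\<bar> * N x) \<and> (\<forall>x y. N (x + y) \<le> N x + N y)"

definition strictly_convex_norm :: "('a::real_vector \<Rightarrow> real) \<Rightarrow> bool" where
  "strictly_convex_norm N \<longleftrightarrow>
     is_norm N \<and> (\<forall>a b. a \<noteq> b \<longrightarrow> \<not> closed_segment a b \<subseteq> {x. N x = 1})"

(* Segments are given by their sets of endpoints. Collinear segments are
   parallel, so only one of them can occur in a pairwise nonparallel family. *)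
definition parallel :: "'a::real_vector set \<Rightarrow> 'a set \<Rightarrow> bool" where
  "parallel e f \<longleftrightarrow> (\<exists>x y u v c. e = {x, y} \<and> f = {u, v} \<and> x \<noteq> y \<and> u \<noteq> v \<and> x - y = c *\<^sub>R (u - v))"

definition unit_segments :: "('a::real_vector \<Rightarrow> real) \<Rightarrow> 'a set \<Rightarrow> 'a set set" where
  "unit_segments N P = {{x, y} | x y. x \<in> P \<and> y \<in> P \<and> N (x - y) = 1}"

definition W_fun :: "'d::finite itself \<Rightarrow> nat \<Rightarrow> nat" where
  "W_fun _ n = Max {card S | S (P :: (real ^ 'd) set) N.
      finite P \<and> card P = n \<and> strictly_convex_norm N \<and>
      S \<subseteq> unit_segments N P \<and> pairwise (\<lambda>e f. \<not> parallel e f) S}"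

(* Not asymp_equiv of Landau_Symbols: two-sided constant bounds, from n = 2 on. *)
definition asymptotically_equivalent :: "(nat \<Rightarrow> nat) \<Rightarrow> (nat \<Rightarrow> nat) \<Rightarrow> bool" where
  "asymptotically_equivalent f g \<longleftrightarrow>
     (\<exists>c1 c2 :: real. c1 > 0 \<and> c2 > 0 \<and>
        (\<forall>n\<ge>2. c1 * real (f n) \<le> real (g n) \<and> real (g n) \<le> c2 * real (f n)))"

end

theory Submission
  imports Defs
begin

text \<open>All three functions are compared with \<open>M(n, n)\<close>. Midpoints of pairs of \<open>P\<close>, scaled by 2, lie
  in \<open>P + P\<close>, and pairwise nonparallel unit segments, read as vectors, give distinct points of
  \<open>P + (- P)\<close> on a strictly convex unit sphere, where every set is convexly independent. Conversely,
  cutting both \<open>P\<close> and \<open>Q\<close> into three parts leaves a ninth of a convexly independent subset of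
  \<open>P + Q\<close> in a sumset \<open>P' + Q'\<close> with \<open>|P'| + |Q'| \<le> n\<close>. Translating \<open>Q'\<close> off \<open>P'\<close> turns its points
  into (doubled) midpoints of pairs of an \<open>n\<close>-set. For unit segments, a translation brings half of its
  points onto the unit sphere of a strictly convex norm, so that they become differences between
  \<open>P'\<close> and a reflected copy of \<open>Q'\<close>.\<close>

section \<open>Finite point sets, sumsets and pairs\<close>

lemma infinite_UNIV_euclidean: "infinite (UNIV :: 'a::euclidean_space set)"
  using finite_imp_bounded not_bounded_UNIV by blast

text \<open>Pads configurations: the extremal functions range over sets of exactly n points, while
  the constructions below yield at most n.\<close>

lemma ex_superset_card:
  fixes A :: "'a::euclidean_space set"
  assumes "finite A" "card A \<le> n"
  obtains B where "A \<subseteq> B" "finite B" "card B = n"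
proof -
  have "infinite (UNIV - A)"
    using assms(1) infinite_UNIV_euclidean by (simp add: Diff_infinite_finite)
  then obtain C where C: "C \<subseteq> UNIV - A" "finite C" "card C = n - card A"
    using infinite_arbitrarily_large by metis
  have "card (A \<union> C) = n"
    using C assms by (subst card_Un_disjoint) auto
  then show ?thesis using that[of "A \<union> C"] C assms by auto
qed

lemma finite_set_plus_card:
  fixes P Q :: "'a::ab_group_add set"
  assumes "finite P" "finite Q"
  shows "finite (P + Q)" "card (P + Q) \<le> card P * card Q"
proof -
  show "finite (P + Q)" unfolding set_plus_image using assms by auto
  show "card (P + Q) \<le> card P * card Q"
    unfolding set_plus_image using card_image_le[of "P \<times> Q" "\<lambda>(x, y). x + y"] assms
    by (simp add: card_cartesian_product)
qed

lemma finite_pairs: "finite P \<Longrightarrow> finite (pairs P)"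
  by (simp add: pairs_def)

lemma card_pairs_le: "finite P \<Longrightarrow> card (pairs P) \<le> 2 ^ card P"
  unfolding card_Pow[symmetric] by (rule card_mono) (auto simp: pairs_def)

lemma unit_segments_subset_pairs:
  assumes "is_norm N"
  shows "unit_segments N P \<subseteq> pairs P"
proof -
  have "N 0 = 0" using assms by (simp add: is_norm_def)
  then have "x \<noteq> y" if "N (x - y) = 1" for x y using that by auto
  then show ?thesis by (auto simp: unit_segments_def pairs_def card_insert_if)
qed

subsection \<open>Strictly convex norms\<close>

lemma is_norm_norm: "is_norm (norm :: 'a::real_normed_vector \<Rightarrow> real)"
  by (auto simp: is_norm_def norm_triangle_ineq)

text \<open>A segment in the unit sphere would have its midpoint there too. The criterion concerns
  the whole ball, so that it passes to maxima of norms.\<close>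

lemma strictly_convex_normI:
  assumes "is_norm N" "\<And>a b. a \<noteq> b \<Longrightarrow> N a \<le> 1 \<Longrightarrow> N b \<le> 1 \<Longrightarrow> N (midpoint a b) < 1"
  shows "strictly_convex_norm N"
  unfolding strictly_convex_norm_def
proof (intro conjI allI impI notI)
  fix a b :: 'a assume "a \<noteq> b" and *: "closed_segment a b \<subseteq> {x. N x = 1}"
  then have "N (midpoint a b) < 1" by (intro assms(2)) auto
  moreover have "N (midpoint a b) = 1" using * midpoint_in_closed_segment by blast
  ultimately show False by simp
qed (fact assms(1))

text \<open>By the parallelogram law, the square of \<open>norm (x + y)\<close> falls short of 4 by
  at least the square of \<open>norm (x - y)\<close>, which is positive.\<close>

lemma norm_midpoint_less_1:
  fixes x y :: "'b::real_inner"
  assumes "x \<noteq> y" "norm x \<le> 1" "norm y \<le> 1"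
  shows "norm (midpoint x y) < 1"
proof -
  have "(norm (x + y))\<^sup>2 + (norm (x - y))\<^sup>2 = 2 * (norm x)\<^sup>2 + 2 * (norm y)\<^sup>2"
    by (simp add: power2_norm_eq_inner inner_simps inner_commute)
  moreover have "(norm x)\<^sup>2 \<le> 1" "(norm y)\<^sup>2 \<le> 1"
    using assms by (auto simp: power_le_one)
  moreover have "(norm (x - y))\<^sup>2 > 0" using assms by auto
  ultimately have "(norm (x + y))\<^sup>2 < 4" by linarith
  then have "(norm (x + y))\<^sup>2 < 2\<^sup>2" by simp
  then have "norm (x + y) < 2" by (rule power_less_imp_less_base) simp
  then show ?thesis by (simp add: midpoint_def)
qed

lemma strictly_convex_norm_norm:
  "strictly_convex_norm (norm :: 'a::real_inner \<Rightarrow> real)"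
  by (intro strictly_convex_normI is_norm_norm norm_midpoint_less_1)

text \<open>The maximum at a midpoint is attained by a single index i. Injectivity of
  \<open>L i\<close> keeps the images of the endpoints distinct, so the strict inequality of the
  inner product norm applies to them.\<close>

lemma strictly_convex_norm_Max_inj_linear:
  fixes L :: "'i \<Rightarrow> 'a::real_vector \<Rightarrow> 'b::real_inner"
  assumes I: "finite I" "I \<noteq> {}" and L: "\<And>i. i \<in> I \<Longrightarrow> linear (L i)" "\<And>i. i \<in> I \<Longrightarrow> inj (L i)"
  shows "strictly_convex_norm (\<lambda>x. Max ((\<lambda>i. norm (L i x)) ` I))"
proof (rule strictly_convex_normI)
  define N where "N x = Max ((\<lambda>i. norm (L i x)) ` I)" for x
  have ge: "norm (L i x) \<le> N x" if "i \<in> I" for i x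
    unfolding N_def using I that by auto
  have att: "\<exists>i\<in>I. N x = norm (L i x)" for x
    unfolding N_def using Max_in[of "(\<lambda>i. norm (L i x)) ` I"] I by blast
  have "is_norm N"
    unfolding is_norm_def
  proof (intro conjI allI)
    show "N x \<ge> 0" for x using att[of x] by auto
    show "N x = 0 \<longleftrightarrow> x = 0" for x
      using att[of x] L I by (auto simp: linear_injective_0 linear_0)
    show "N (c *\<^sub>R x) = \<bar>c\<bar> * N x" for c x
    proof (rule antisym)
      obtain i where "i \<in> I" "N (c *\<^sub>R x) = norm (L i (c *\<^sub>R x))" using att by blast
      then show "N (c *\<^sub>R x) \<le> \<bar>c\<bar> * N x"
        using ge L by (simp add: linear_cmul mult_left_mono)
      obtain i where "i \<in> I" "N x = norm (L i x)" using att by blast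
      then show "\<bar>c\<bar> * N x \<le> N (c *\<^sub>R x)"
        using ge[of i "c *\<^sub>R x"] L by (simp add: linear_cmul)
    qed
    show "N (x + y) \<le> N x + N y" for x y
    proof -
      obtain i where "i \<in> I" "N (x + y) = norm (L i (x + y))" using att by blast
      then show ?thesis
        using ge[of i x] ge[of i y] L norm_triangle_ineq[of "L i x" "L i y"]
        by (simp add: linear_add)
    qed
  qed
  then show "is_norm (\<lambda>x. Max ((\<lambda>i. norm (L i x)) ` I))" by (simp add: N_def[abs_def])
  have "N (midpoint a b) < 1" if "a \<noteq> b" "N a \<le> 1" "N b \<le> 1" for a b
  proof -
    obtain i where i: "i \<in> I" "N (midpoint a b) = norm (L i (midpoint a b))" using att by blast
    have "L i (midpoint a b) = midpoint (L i a) (L i b)"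
      using L(1)[OF i(1)] by (simp add: midpoint_def linear_cmul linear_add)
    moreover have "L i a \<noteq> L i b" using L(2)[OF i(1)] that(1) by (simp add: inj_eq)
    ultimately show ?thesis
      using i norm_midpoint_less_1[of "L i a" "L i b"] ge[OF i(1), of a] ge[OF i(1), of b] that by simp
  qed
  then show "a \<noteq> b \<Longrightarrow> Max ((\<lambda>i. norm (L i a)) ` I) \<le> 1 \<Longrightarrow> Max ((\<lambda>i. norm (L i b)) ` I) \<le> 1 \<Longrightarrow>
      Max ((\<lambda>i. norm (L i (midpoint a b))) ` I) < 1" for a b by (simp add: N_def)
qed

text \<open>If x were interior to a segment in the ball, a short piece of that segment centred at x
  would lie entirely in the sphere, against strict convexity.\<close>

lemma strictly_convex_norm_sphere_extreme:
  assumes N: "strictly_convex_norm N" and x: "N x = 1"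
  shows "x extreme_point_of {y. N y \<le> 1}"
  unfolding extreme_point_of_def
proof (intro conjI ballI notI)
  show "x \<in> {y. N y \<le> 1}" using x by simp
  have tri: "N (y + z) \<le> N y + N z" and scale: "N (c *\<^sub>R y) = \<bar>c\<bar> * N y" for y z c
    using N by (auto simp: strictly_convex_norm_def is_norm_def)
  fix a b assume "a \<in> {y. N y \<le> 1}" "b \<in> {y. N y \<le> 1}" "x \<in> open_segment a b"
  then have ab: "N a \<le> 1" "N b \<le> 1" "a \<noteq> b"
    and "\<exists>u. 0 < u \<and> u < 1 \<and> x = (1 - u) *\<^sub>R a + u *\<^sub>R b"
    by (auto simp: in_segment)
  then obtain u where u: "0 < u" "u < 1" "x = (1 - u) *\<^sub>R a + u *\<^sub>R b" by blast
  \<comment> \<open>With this half-width, \<open>u + t\<close> stays in the unit interval for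
    \<open>\<bar>t\<bar> \<le> r\<close>, so the shifted point is still a convex combination of a
    and b.\<close>
  define r where "r = min u (1 - u)"
  have r: "0 < r" "r \<le> u" "r \<le> 1 - u" using u by (auto simp: r_def)
  have le1: "N (x + t *\<^sub>R (b - a)) \<le> 1" if "\<bar>t\<bar> \<le> r" for t
  proof -
    have "x + t *\<^sub>R (b - a) = (1 - (u + t)) *\<^sub>R a + (u + t) *\<^sub>R b"
      using u by (simp add: algebra_simps)
    then have "N (x + t *\<^sub>R (b - a)) \<le> \<bar>1 - (u + t)\<bar> * N a + \<bar>u + t\<bar> * N b"
      using tri[of "(1 - (u + t)) *\<^sub>R a" "(u + t) *\<^sub>R b"] by (simp add: scale)
    also have "\<dots> \<le> \<bar>1 - (u + t)\<bar> * 1 + \<bar>u + t\<bar> * 1"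
      using ab by (intro add_mono mult_left_mono) auto
    also have "\<dots> = 1" using r that by auto
    finally show ?thesis .
  qed
  \<comment> \<open>x is the midpoint of the points shifted by t and by -t. Their norms are at most
    1 and sum to at least 2, so both equal 1.\<close>
  have "N (x + t *\<^sub>R (b - a)) = 1" if "\<bar>t\<bar> \<le> r" for t
  proof -
    have "2 *\<^sub>R x = (x + t *\<^sub>R (b - a)) + (x + (- t) *\<^sub>R (b - a))"
      by (simp add: scaleR_2)
    then have "2 \<le> N (x + t *\<^sub>R (b - a)) + N (x + (- t) *\<^sub>R (b - a))"
      using tri[of "x + t *\<^sub>R (b - a)" "x + (- t) *\<^sub>R (b - a)"] scale[of 2 x] x by simp
    then show ?thesis using le1[of t] le1[of "- t"] that by simp
  qed
  moreover have "\<exists>t. \<bar>t\<bar> \<le> r \<and> y = x + t *\<^sub>R (b - a)"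
    if "y \<in> closed_segment (x - r *\<^sub>R (b - a)) (x + r *\<^sub>R (b - a))" for y
  proof -
    obtain v where v: "0 \<le> v" "v \<le> 1"
        "y = (1 - v) *\<^sub>R (x - r *\<^sub>R (b - a)) + v *\<^sub>R (x + r *\<^sub>R (b - a))"
      using \<open>y \<in> _\<close> by (auto simp: in_segment)
    \<comment> \<open>Auxiliary identity that merges the two equal summands produced by
      \<open>algebra_simps\<close>.\<close>
    have "(r * (v * 2)) *\<^sub>R w = (r * v) *\<^sub>R w + (r * v) *\<^sub>R w" for w :: 'a
      by (simp flip: scaleR_left_distrib)
    then have "y = x + ((2 * v - 1) * r) *\<^sub>R (b - a)" using v(3) by (simp add: algebra_simps)
    moreover have "\<bar>(2 * v - 1) * r\<bar> \<le> r"
      using v r mult_right_mono[of "\<bar>2 * v - 1\<bar>" 1 r] by (auto simp: abs_mult)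
    ultimately show ?thesis by blast
  qed
  ultimately have "closed_segment (x - r *\<^sub>R (b - a)) (x + r *\<^sub>R (b - a)) \<subseteq> {y. N y = 1}"
    by blast
  moreover have "x - r *\<^sub>R (b - a) \<noteq> x + r *\<^sub>R (b - a)"
  proof
    assume "x - r *\<^sub>R (b - a) = x + r *\<^sub>R (b - a)"
    moreover have "2 *\<^sub>R r *\<^sub>R (b - a) = (x + r *\<^sub>R (b - a)) - (x - r *\<^sub>R (b - a))"
      unfolding scaleR_2 by simp
    ultimately have "2 *\<^sub>R r *\<^sub>R (b - a) = 0" by simp
    then show False using ab r by simp
  qed
  ultimately show False using N unfolding strictly_convex_norm_def by blast
qed

lemma convex_unit_ball_is_norm:
  assumes "is_norm N"
  shows "convex {y. N y \<le> 1}"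
proof (rule convexI)
  fix x y and u v :: real
  assume *: "x \<in> {y. N y \<le> 1}" "y \<in> {y. N y \<le> 1}" "0 \<le> u" "0 \<le> v" "u + v = 1"
  have "N (u *\<^sub>R x + v *\<^sub>R y) \<le> N (u *\<^sub>R x) + N (v *\<^sub>R y)"
    using assms unfolding is_norm_def by blast
  also have "\<dots> = u * N x + v * N y" using assms * by (simp add: is_norm_def)
  also have "\<dots> \<le> u * 1 + v * 1" using * by (intro add_mono mult_left_mono) auto
  finally show "u *\<^sub>R x + v *\<^sub>R y \<in> {y. N y \<le> 1}" using * by simp
qed

text \<open>Each x in X is an extreme point of the unit ball, so the ball without x is still convex
  and contains the hull of the other points.\<close>

lemma convexly_independent_unit_sphere:
  assumes N: "strictly_convex_norm N" and X: "\<And>x. x \<in> X \<Longrightarrow> N x = 1"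
  shows "convexly_independent X"
  unfolding convexly_independent_def
proof
  fix x assume x: "x \<in> X"
  have "convex {y. N y \<le> 1}"
    using N by (intro convex_unit_ball_is_norm) (simp add: strictly_convex_norm_def)
  then have "convex ({y. N y \<le> 1} - {x})"
    using strictly_convex_norm_sphere_extreme[OF N X[OF x]]
    by (simp add: extreme_point_of_stillconvex)
  then have "convex hull (X - {x}) \<subseteq> {y. N y \<le> 1} - {x}"
    using X by (intro hull_minimal) auto
  then show "x \<notin> convex hull (X - {x})" by blast
qed

text \<open>The norm is the maximum of Euclidean norms, one for each \<open>i\<close>, whose unit ball is an
  ellipsoid, touching the hyperplane \<open>b i \<bullet> x = 1\<close> at \<open>y i\<close> and elongated along it so far that it
  contains the other \<open>y j\<close>.\<close>

lemma ex_strictly_convex_norm_through: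
  fixes y b :: "'i \<Rightarrow> 'a::real_inner"
  assumes I: "finite I" and one: "\<And>i. i \<in> I \<Longrightarrow> b i \<bullet> y i = 1"
    and less: "\<And>i j. i \<in> I \<Longrightarrow> j \<in> I \<Longrightarrow> i \<noteq> j \<Longrightarrow> \<bar>b i \<bullet> y j\<bar> < 1"
  obtains N where "strictly_convex_norm N" "\<And>i. i \<in> I \<Longrightarrow> N (y i) = 1"
proof (cases "I = {}")
  case True
  then show ?thesis using that strictly_convex_norm_norm by auto
next
  case False
  \<comment> \<open>The first coordinate is the functional \<open>b i\<close>, the second the
    component in its kernel, scaled by e. A small e elongates the ellipsoid along that
    kernel.\<close>
  define L where "L e i x = (b i \<bullet> x, e *\<^sub>R (x - (b i \<bullet> x) *\<^sub>R y i))" for e :: real and i x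
  have Lii: "norm (L e i (y i)) = 1" if "i \<in> I" for e i
    using one[OF that] by (simp add: L_def norm_Pair)
  have "\<forall>\<^sub>F e in at_right 0. norm (L e i (y j)) \<le> 1" if "i \<in> I" "j \<in> I" for i j
  proof (cases "i = j")
    case True
    then show ?thesis using Lii[OF that(1)] by simp
  next
    case False
    \<comment> \<open>In the limit only the first coordinate survives, and \<open>less\<close> puts
      it strictly below 1. As there are finitely many pairs (i, j), one e serves them all.\<close>
    have "((\<lambda>e. norm (L e i (y j))) \<longlongrightarrow> norm (b i \<bullet> y j, 0 *\<^sub>R (y j - (b i \<bullet> y j) *\<^sub>R y i)))
        (at_right 0)"
      unfolding L_def by (intro tendsto_intros)
    then have "\<forall>\<^sub>F e in at_right 0. norm (L e i (y j)) < 1"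
      using less[OF that False] by (intro order_tendstoD(2)) (auto simp: norm_Pair)
    then show ?thesis by eventually_elim simp
  qed
  then have "\<forall>\<^sub>F e in at_right (0::real). \<forall>i\<in>I. \<forall>j\<in>I. norm (L e i (y j)) \<le> 1"
    using I by (intro eventually_ball_finite ballI) auto
  moreover have "\<forall>\<^sub>F e in at_right (0::real). 0 < e"
    by (simp add: eventually_at_right_less)
  ultimately have "\<forall>\<^sub>F e in at_right (0::real). 0 < e \<and> (\<forall>i\<in>I. \<forall>j\<in>I. norm (L e i (y j)) \<le> 1)"
    by eventually_elim simp
  then obtain e :: real where e: "0 < e" "\<And>i j. i \<in> I \<Longrightarrow> j \<in> I \<Longrightarrow> norm (L e i (y j)) \<le> 1"
    using eventually_happens'[OF trivial_limit_at_right_real] by blast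
  have "linear (L e i)" for i
    unfolding L_def by (intro linearI) (auto simp: inner_simps algebra_simps)
  moreover have "inj (L e i)" for i
  proof -
    have "x = 0" if "L e i x = 0" for x
    proof -
      have "b i \<bullet> x = 0" "x = (b i \<bullet> x) *\<^sub>R y i"
        using that e(1) by (auto simp: L_def zero_prod_def)
      then show ?thesis by simp
    qed
    then show ?thesis using linear_injective_0[OF \<open>linear (L e i)\<close>] by blast
  qed
  ultimately have "strictly_convex_norm (\<lambda>x. Max ((\<lambda>i. norm (L e i x)) ` I))"
    using I False by (intro strictly_convex_norm_Max_inj_linear) auto
  moreover have "Max ((\<lambda>i. norm (L e i (y j))) ` I) = 1" if "j \<in> I" for j
  proof (rule Max_eqI)
    show "1 \<in> (\<lambda>i. norm (L e i (y j))) ` I" using Lii[OF that] that by force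
  qed (use I e(2) that in auto)
  ultimately show ?thesis by (rule that)
qed

subsection \<open>Convexly independent sets\<close>

lemma convexly_independent_subset:
  assumes "convexly_independent S" "T \<subseteq> S"
  shows "convexly_independent T"
  unfolding convexly_independent_def
proof
  fix x assume "x \<in> T"
  then have "x \<notin> convex hull (S - {x})"
    using assms by (auto simp: convexly_independent_def)
  moreover have "convex hull (T - {x}) \<subseteq> convex hull (S - {x})"
    using assms(2) by (intro hull_mono) auto
  ultimately show "x \<notin> convex hull (T - {x})" by blast
qed

lemma convexly_independent_affinity:
  assumes "convexly_independent S" "c \<noteq> 0"
  shows "convexly_independent ((\<lambda>x. a + c *\<^sub>R x) ` S)"
  unfolding convexly_independent_def
proof
  fix z assume "z \<in> (\<lambda>x. a + c *\<^sub>R x) ` S"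
  then obtain x where x: "x \<in> S" "z = a + c *\<^sub>R x" by blast
  have "(\<lambda>x. a + c *\<^sub>R x) ` S - {z} = (\<lambda>x. a + c *\<^sub>R x) ` (S - {x})"
    using x assms(2) by auto
  then have "convex hull ((\<lambda>x. a + c *\<^sub>R x) ` S - {z}) = (\<lambda>x. a + c *\<^sub>R x) ` (convex hull (S - {x}))"
    by (simp only: convex_hull_affinity)
  moreover have "x \<notin> convex hull (S - {x})"
    using assms(1) x(1) by (simp add: convexly_independent_def)
  ultimately show "z \<notin> convex hull ((\<lambda>x. a + c *\<^sub>R x) ` S - {z})"
    using x assms(2) by auto
qed

text \<open>The hull of the other points is compact and convex and misses s. After moving s to the
  origin it is strictly separated from 0, and the normal vector is negated.\<close>

lemma convexly_independent_supporting:
  fixes S :: "'a::euclidean_space set"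
  assumes "finite S" "convexly_independent S" "s \<in> S"
  obtains a where "a \<noteq> 0" "\<And>x. x \<in> S \<Longrightarrow> x \<noteq> s \<Longrightarrow> a \<bullet> x < a \<bullet> s"
proof -
  let ?T = "(\<lambda>x. - s + x) ` (convex hull (S - {s}))"
  have "convex ?T" by (intro convex_translation convex_convex_hull)
  moreover have "closed ?T"
    using assms(1) by (intro closed_translation compact_imp_closed finite_imp_compact_convex_hull) auto
  moreover have "0 \<notin> ?T" using assms(2,3) by (auto simp: convexly_independent_def)
  ultimately obtain a b where ab: "a \<noteq> 0" "0 < b" "\<And>x. x \<in> ?T \<Longrightarrow> a \<bullet> x > b"
    using separating_hyperplane_closed_0[of ?T] by blast
  have "(- a) \<bullet> x < (- a) \<bullet> s" if "x \<in> S" "x \<noteq> s" for x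
  proof -
    have "x \<in> convex hull (S - {s})" using that by (intro hull_inc) auto
    then have "a \<bullet> (- s + x) > b" by (intro ab(3)) auto
    then show ?thesis using ab(2) by (simp add: inner_simps)
  qed
  then show ?thesis using that[of "- a"] ab(1) by simp
qed

text \<open>Finitely many hyperplanes form a null set and cannot cover the space.\<close>

lemma ex_nonorthogonal_to_finite:
  fixes a :: "'i \<Rightarrow> 'a::euclidean_space"
  assumes "finite I" "\<And>i. i \<in> I \<Longrightarrow> a i \<noteq> 0"
  obtains u where "\<And>i. i \<in> I \<Longrightarrow> a i \<bullet> u \<noteq> 0"
proof -
  have "negligible (\<Union>i\<in>I. {x. a i \<bullet> x = 0})"
    using assms by (intro negligible_Union) (auto intro: negligible_hyperplane)
  then have "(\<Union>i\<in>I. {x. a i \<bullet> x = 0}) \<noteq> UNIV" using non_negligible_UNIV by metis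
  then show ?thesis using that by blast
qed

text \<open>Translating far in a direction \<open>u\<close> makes the points whose supporting functional is positive
  on \<open>u\<close> convexly independent together with their reflections in the origin; for one of \<open>u\<close>,
  \<open>- u\<close> these are at least half of the points.\<close>

lemma half_on_translated_unit_sphere:
  fixes S :: "'a::euclidean_space set"
  assumes S: "finite S" "convexly_independent S"
  obtains T t N where "T \<subseteq> S" "card S \<le> 2 * card T" "strictly_convex_norm N"
    "\<And>x. x \<in> T \<Longrightarrow> N (x - t) = 1"
    "\<And>x y. x \<in> T \<Longrightarrow> y \<in> T \<Longrightarrow> x - t \<noteq> - (y - t)"
proof -
  have "\<forall>s\<in>S. \<exists>a. a \<noteq> 0 \<and> (\<forall>x\<in>S. x \<noteq> s \<longrightarrow> a \<bullet> x < a \<bullet> s)"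
  proof
    fix s assume "s \<in> S"
    then show "\<exists>a. a \<noteq> 0 \<and> (\<forall>x\<in>S. x \<noteq> s \<longrightarrow> a \<bullet> x < a \<bullet> s)"
      by (rule convexly_independent_supporting[OF S]) auto
  qed
  then obtain a where "\<forall>s\<in>S. a s \<noteq> 0 \<and> (\<forall>x\<in>S. x \<noteq> s \<longrightarrow> a s \<bullet> x < a s \<bullet> s)"
    by (rule bchoice[THEN exE])
  then have a: "\<And>s. s \<in> S \<Longrightarrow> a s \<noteq> 0"
      "\<And>s x. s \<in> S \<Longrightarrow> x \<in> S \<Longrightarrow> x \<noteq> s \<Longrightarrow> a s \<bullet> x < a s \<bullet> s"
    by auto
  obtain u0 where u0: "\<And>s. s \<in> S \<Longrightarrow> a s \<bullet> u0 \<noteq> 0"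
    using ex_nonorthogonal_to_finite[OF S(1), of a] a(1) by blast
  have "S = {s \<in> S. a s \<bullet> u0 > 0} \<union> {s \<in> S. a s \<bullet> (- u0) > 0}"
    using u0 by (force simp: neq_iff)
  then have "card S \<le> card {s \<in> S. a s \<bullet> u0 > 0} + card {s \<in> S. a s \<bullet> (- u0) > 0}"
    using card_Un_le by metis
  then consider "card S \<le> 2 * card {s \<in> S. a s \<bullet> u0 > 0}"
    | "card S \<le> 2 * card {s \<in> S. a s \<bullet> (- u0) > 0}"
    by linarith
  then obtain u where u: "card S \<le> 2 * card {s \<in> S. a s \<bullet> u > 0}"
    by cases blast+
  define T where "T = {s \<in> S. a s \<bullet> u > 0}"
  have T: "T \<subseteq> S" "finite T" using S by (auto simp: T_def)
  have "\<forall>\<^sub>F l in at_top. - (a s \<bullet> (x + l *\<^sub>R u)) < a s \<bullet> (s + l *\<^sub>R u)" if "s \<in> T" for s x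
  proof -
    have pos: "a s \<bullet> u > 0" using that by (simp add: T_def)
    show ?thesis
      \<comment> \<open>The inequality is linear in l with slope
        \<open>2 * (a s \<bullet> u)\<close>, positive on T; this is its threshold.\<close>
      using eventually_gt_at_top[of "- (a s \<bullet> s + a s \<bullet> x) / (2 * (a s \<bullet> u))"]
    proof eventually_elim
      case (elim l)
      then show ?case using pos by (simp add: inner_simps field_simps)
    qed
  qed
  then have "\<forall>\<^sub>F l in at_top. \<forall>s\<in>T. \<forall>x\<in>T. - (a s \<bullet> (x + l *\<^sub>R u)) < a s \<bullet> (s + l *\<^sub>R u)"
    using T by (intro eventually_ball_finite ballI) auto
  then obtain l where l: "\<And>s x. s \<in> T \<Longrightarrow> x \<in> T \<Longrightarrow> - (a s \<bullet> (x + l *\<^sub>R u)) < a s \<bullet> (s + l *\<^sub>R u)"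
    using eventually_happens'[OF trivial_limit_at_top_linorder] by blast
  \<comment> \<open>Subtracting t translates by \<open>l *\<^sub>R u\<close>, and \<open>k s\<close>
    is the level of the supporting hyperplane at the translate of s. It is positive by
    \<open>above_reflection\<close> with x = s.\<close>
  define t where "t = - (l *\<^sub>R u)"
  define k where "k s = a s \<bullet> (s - t)" for s
  have above_reflection: "- (a s \<bullet> (x - t)) < k s" if "s \<in> T" "x \<in> T" for s x
    using l[OF that] by (simp add: k_def t_def)
  have kpos: "k s > 0" if "s \<in> T" for s
    using above_reflection[OF that that] by (simp add: k_def)
  have less: "a s \<bullet> (x - t) < k s" if "s \<in> T" "x \<in> T" "s \<noteq> x" for s x
    using a(2)[of s x] that T(1) by (auto simp: k_def inner_simps)
  obtain N where N: "strictly_convex_norm N" "\<And>x. x \<in> T \<Longrightarrow> N (x - t) = 1"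
  \<comment> \<open>Division by \<open>k s\<close> moves the supporting hyperplane to level 1. The
    facts \<open>less\<close> and \<open>above_reflection\<close> are the two halves of the absolute
    value bound.\<close>
  proof (rule ex_strictly_convex_norm_through[of T "\<lambda>s. (1 / k s) *\<^sub>R a s" "\<lambda>x. x - t"])
    show "finite T" by (rule T(2))
    show "(1 / k s) *\<^sub>R a s \<bullet> (s - t) = 1" if "s \<in> T" for s
      using kpos[OF that] by (simp add: k_def)
    show "\<bar>(1 / k s) *\<^sub>R a s \<bullet> (x - t)\<bar> < 1" if "s \<in> T" "x \<in> T" "s \<noteq> x" for s x
      using kpos[OF that(1)] above_reflection[OF that(1,2)] less[OF that] by (simp add: abs_mult field_simps abs_less_iff)
  qed (rule that)
  have "x - t \<noteq> - (y - t)" if "x \<in> T" "y \<in> T" for x y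
  proof
    assume "x - t = - (y - t)"
    then have "a x \<bullet> (x - t) = - (a x \<bullet> (y - t))" by (metis inner_minus_right)
    then show False using above_reflection[OF that] by (simp add: k_def)
  qed
  then show ?thesis using that[of T N t] T(1) u N by (auto simp: T_def)
qed


subsection \<open>The extremal functions as maxima\<close>

text \<open>\<open>Max\<close> is meaningful only on finite nonempty sets; for naturals an upper
  bound gives finiteness.\<close>

lemma Max_attained_and_bound:
  fixes A :: "nat set"
  assumes "A \<noteq> {}" "\<And>x. x \<in> A \<Longrightarrow> x \<le> b"
  shows "Max A \<in> A" "\<And>x. x \<in> A \<Longrightarrow> x \<le> Max A"
proof -
  have "finite A" using assms(2) finite_nat_set_iff_bounded_le by blast
  then show "Max A \<in> A" "\<And>x. x \<in> A \<Longrightarrow> x \<le> Max A" using assms(1) by auto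
qed

text \<open>The empty family always competes, and the number of pairs bounds every competitor. The
  next three lemmas follow the same scheme, with bounds \<open>2 ^ n\<close>, \<open>m * n\<close>
  and \<open>2 ^ n\<close>.\<close>

lemma E_of_Max:
  assumes "finite P"
  shows "E_of P \<in> {card S | S. S \<subseteq> pairs P \<and> inj_on pair_midpoint S
                        \<and> convexly_independent (pair_midpoint ` S)}"
    and "S \<subseteq> pairs P \<Longrightarrow> inj_on pair_midpoint S \<Longrightarrow>
           convexly_independent (pair_midpoint ` S) \<Longrightarrow> card S \<le> E_of P"
proof -
  let ?A = "{card S | S. S \<subseteq> pairs P \<and> inj_on pair_midpoint S
                        \<and> convexly_independent (pair_midpoint ` S)}"
  have "card {} \<in> ?A"
    by (intro CollectI exI[of _ "{}"]) (auto simp: convexly_independent_def)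
  then have 1: "?A \<noteq> {}" by blast
  have 2: "x \<le> card (pairs P)" if "x \<in> ?A" for x
    using that card_mono[OF finite_pairs[OF assms]] by auto
  show "E_of P \<in> ?A"
    unfolding E_of_def by (rule Max_attained_and_bound(1)[OF 1 2])
  show "card S \<le> E_of P" if "S \<subseteq> pairs P" "inj_on pair_midpoint S"
      "convexly_independent (pair_midpoint ` S)"
    unfolding E_of_def using that by (intro Max_attained_and_bound(2)[OF 1 2]) auto
qed

lemma E_fun_Max:
  fixes d :: "'d::finite itself"
  shows "E_fun d n \<in> {E_of P | P :: (real ^ 'd) set. finite P \<and> card P = n}"
    and "finite (P :: (real ^ 'd) set) \<Longrightarrow> card P = n \<Longrightarrow> E_of P \<le> E_fun d n"
proof -
  let ?A = "{E_of P | P :: (real ^ 'd) set. finite P \<and> card P = n}"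
  obtain B :: "(real ^ 'd) set" where "finite B" "card B = n"
    using ex_superset_card[of "{}" n] by auto
  then have 1: "?A \<noteq> {}" by blast
  have 2: "x \<le> 2 ^ n" if "x \<in> ?A" for x
  proof -
    obtain P :: "(real ^ 'd) set" where P: "x = E_of P" "finite P" "card P = n"
      using \<open>x \<in> ?A\<close> by blast
    obtain S where "S \<subseteq> pairs P" "x = card S" using E_of_Max(1)[OF P(2)] P(1) by auto
    then have "x \<le> card (pairs P)" using card_mono finite_pairs P(2) by blast
    then show ?thesis using card_pairs_le[OF P(2)] P(3) by simp
  qed
  show "E_fun d n \<in> ?A"
    unfolding E_fun_def by (rule Max_attained_and_bound(1)[OF 1 2])
  show "E_of P \<le> E_fun d n" if "finite P" "card P = n" for P :: "(real ^ 'd) set"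
    unfolding E_fun_def using that by (intro Max_attained_and_bound(2)[OF 1 2]) auto
qed

lemma M_fun_Max:
  fixes d :: "'d::finite itself"
  shows "M_fun d m n \<in> {card S | S P Q :: (real ^ 'd) set.
      finite P \<and> card P = m \<and> finite Q \<and> card Q = n \<and> S \<subseteq> P + Q \<and> convexly_independent S}"
    and "\<And>S P Q :: (real ^ 'd) set. finite P \<Longrightarrow> card P = m \<Longrightarrow> finite Q \<Longrightarrow> card Q = n \<Longrightarrow>
      S \<subseteq> P + Q \<Longrightarrow> convexly_independent S \<Longrightarrow> card S \<le> M_fun d m n"
proof -
  let ?A = "{card S | S P Q :: (real ^ 'd) set.
      finite P \<and> card P = m \<and> finite Q \<and> card Q = n \<and> S \<subseteq> P + Q \<and> convexly_independent S}"
  obtain P Q :: "(real ^ 'd) set" where "finite P" "card P = m" "finite Q" "card Q = n"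
    using ex_superset_card[of "{}"] by (metis card.empty finite.emptyI zero_le)
  then have "card ({} :: (real ^ 'd) set) \<in> ?A"
    by (intro CollectI exI[of _ "{}"] exI[of _ P] exI[of _ Q]) (auto simp: convexly_independent_def)
  then have 1: "?A \<noteq> {}" by blast
  have 2: "x \<le> m * n" if "x \<in> ?A" for x
  proof -
    obtain S P Q :: "(real ^ 'd) set" where "x = card S" "finite P" "card P = m"
        "finite Q" "card Q = n" "S \<subseteq> P + Q"
      using \<open>x \<in> ?A\<close> by auto
    then show ?thesis
      using finite_set_plus_card[of P Q] card_mono[of "P + Q" S] by (metis le_trans)
  qed
  show "M_fun d m n \<in> ?A"
    unfolding M_fun_def by (rule Max_attained_and_bound(1)[OF 1 2])
  show "card S \<le> M_fun d m n" if "finite P" "card P = m" "finite Q" "card Q = n"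
      "S \<subseteq> P + Q" "convexly_independent S" for S P Q :: "(real ^ 'd) set"
    unfolding M_fun_def using that by (intro Max_attained_and_bound(2)[OF 1 2]) auto
qed

lemma W_fun_Max:
  fixes d :: "'d::finite itself"
  shows "W_fun d n \<in> {card S | S (P :: (real ^ 'd) set) N.
      finite P \<and> card P = n \<and> strictly_convex_norm N \<and>
      S \<subseteq> unit_segments N P \<and> pairwise (\<lambda>e f. \<not> parallel e f) S}"
    and "\<And>S (P :: (real ^ 'd) set) N. finite P \<Longrightarrow> card P = n \<Longrightarrow> strictly_convex_norm N \<Longrightarrow>
      S \<subseteq> unit_segments N P \<Longrightarrow> pairwise (\<lambda>e f. \<not> parallel e f) S \<Longrightarrow> card S \<le> W_fun d n"
proof -
  let ?A = "{card S | S (P :: (real ^ 'd) set) N.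
      finite P \<and> card P = n \<and> strictly_convex_norm N \<and>
      S \<subseteq> unit_segments N P \<and> pairwise (\<lambda>e f. \<not> parallel e f) S}"
  obtain P :: "(real ^ 'd) set" where "finite P" "card P = n"
    using ex_superset_card[of "{}" n] by auto
  then have "card ({} :: (real ^ 'd) set set) \<in> ?A"
    using strictly_convex_norm_norm
    by (intro CollectI exI[of _ "{}"] exI[of _ P] exI[of _ norm]) (auto simp: pairwise_def)
  then have 1: "?A \<noteq> {}" by blast
  have 2: "x \<le> 2 ^ n" if "x \<in> ?A" for x
  proof -
    obtain S N and P :: "(real ^ 'd) set" where *: "x = card S" "finite P" "card P = n"
        "strictly_convex_norm N" "S \<subseteq> unit_segments N P"
      using \<open>x \<in> ?A\<close> by blast
    then have "S \<subseteq> pairs P"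
      using unit_segments_subset_pairs strictly_convex_norm_def by blast
    then have "card S \<le> card (pairs P)" by (rule card_mono[OF finite_pairs[OF *(2)]])
    then show ?thesis using card_pairs_le[OF *(2)] * by simp
  qed
  show "W_fun d n \<in> ?A"
    unfolding W_fun_def by (rule Max_attained_and_bound(1)[OF 1 2])
  show "card S \<le> W_fun d n" if "finite P" "card P = n" "strictly_convex_norm N"
      "S \<subseteq> unit_segments N P" "pairwise (\<lambda>e f. \<not> parallel e f) S" for S N and P :: "(real ^ 'd) set"
  proof -
    have "card S \<in> ?A"
      using that by (intro CollectI exI[of _ S] exI[of _ P] exI[of _ N] conjI refl)
    with 1 2 show ?thesis
      unfolding W_fun_def by (rule Max_attained_and_bound(2))
  qed
qed

subsection \<open>Upper bounds by the sumset problem\<close>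

lemma E_fun_le_M_fun:
  fixes d :: "'d::finite itself"
  shows "E_fun d n \<le> M_fun d n n"
proof -
  obtain P :: "(real ^ 'd) set" where P: "E_fun d n = E_of P" "finite P" "card P = n"
    using E_fun_Max(1)[of d n] by blast
  obtain S where S: "E_of P = card S" "S \<subseteq> pairs P" "inj_on pair_midpoint S"
      "convexly_independent (pair_midpoint ` S)"
    using E_of_Max(1)[OF P(2)] by blast
  \<comment> \<open>Doubling turns the midpoint of x and y into x + y. The summand 0 gives the map
    the shape used in \<open>convexly_independent_affinity\<close>.\<close>
  define T where "T = (\<lambda>x. 0 + 2 *\<^sub>R x) ` pair_midpoint ` S"
  have "inj (\<lambda>x :: real ^ 'd. 0 + 2 *\<^sub>R x)" by (auto simp: inj_def)
  then have "card T = card S"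
    unfolding T_def using S(3) by (metis card_image inj_on_subset subset_UNIV)
  moreover have "convexly_independent T"
    unfolding T_def by (intro convexly_independent_affinity S(4)) simp
  moreover have "0 + 2 *\<^sub>R pair_midpoint e \<in> P + P" if "e \<in> S" for e
  proof -
    obtain x y where "e = {x, y}" "x \<noteq> y" "x \<in> P" "y \<in> P"
      using S(2) \<open>e \<in> S\<close> by (auto simp: pairs_def card_2_iff)
    then show ?thesis by (auto simp: pair_midpoint_def)
  qed
  then have "T \<subseteq> P + P" by (auto simp: T_def)
  ultimately show ?thesis using M_fun_Max(2)[of P n P n T d] P S(1) by simp
qed

lemma W_fun_le_M_fun:
  fixes d :: "'d::finite itself"
  shows "W_fun d n \<le> M_fun d n n"
proof -
  obtain S N and P :: "(real ^ 'd) set" where S: "W_fun d n = card S" "finite P" "card P = n"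
      "strictly_convex_norm N" "S \<subseteq> unit_segments N P" "pairwise (\<lambda>e f. \<not> parallel e f) S"
    using W_fun_Max(1)[of d n] by blast
  have "\<forall>e\<in>S. \<exists>x y. e = {x, y} \<and> x \<in> P \<and> y \<in> P \<and> N (x - y) = 1"
    using S(5) by (auto simp: unit_segments_def)
  then obtain x y where xy: "\<And>e. e \<in> S \<Longrightarrow> e = {x e, y e} \<and> x e \<in> P \<and> y e \<in> P \<and> N (x e - y e) = 1"
    by metis
  \<comment> \<open>An arbitrary orientation turns each segment into a unit vector. Equal vectors
    would make two segments parallel with factor 1, hence v is injective on S.\<close>
  define v where "v e = x e - y e" for e
  have "inj_on v S"
  proof (rule inj_onI, rule ccontr)
    fix e f assume *: "e \<in> S" "f \<in> S" "v e = v f" "e \<noteq> f"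
    have "N 0 = 0" using S(4) by (simp add: strictly_convex_norm_def is_norm_def)
    then have "x e \<noteq> y e" "x f \<noteq> y f" using xy *(1,2) by force+
    moreover have "x e - y e = 1 *\<^sub>R (x f - y f)" using * by (simp add: v_def)
    ultimately have "parallel e f" unfolding parallel_def using xy *(1,2) by blast
    then show False using S(6) * by (auto simp: pairwise_def)
  qed
  then have "card (v ` S) = card S" by (rule card_image)
  moreover have "convexly_independent (v ` S)"
    using S(4) xy by (intro convexly_independent_unit_sphere[of N]) (auto simp: v_def)
  moreover have "v ` S \<subseteq> P + uminus ` P"
  proof
    fix z assume "z \<in> v ` S"
    then obtain e where "e \<in> S" "z = x e + (- y e)" by (auto simp: v_def)
    then show "z \<in> P + uminus ` P" using xy by blast
  qed
  moreover have "card (uminus ` P) = n" using S(3) by (simp add: card_image)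
  ultimately show ?thesis
    using M_fun_Max(2)[of P n "uminus ` P" n "v ` S" d] S(1-3) by simp
qed

subsection \<open>Reduction to sumsets of half the size\<close>

text \<open>The parts are blocks of k consecutive indices of an enumeration. With k = n div 2, two
  blocks would miss a point when n is odd.\<close>

lemma ex_three_part_cover:
  assumes "finite P" "card P \<le> 3 * k"
  obtains A :: "nat \<Rightarrow> 'a set" where "P = (\<Union>i<3. A i)" "\<And>i. card (A i) \<le> k"
proof -
  obtain h where h: "bij_betw h P {0..<card P}" using ex_bij_betw_finite_nat[OF assms(1)] by blast
  define A where "A i = {x \<in> P. i * k \<le> h x \<and> h x < i * k + k}" for i
  have "card (A i) \<le> k" for i
  proof -
    have "inj_on h (A i)" using h by (auto simp: A_def bij_betw_def inj_on_def)
    moreover have "h ` A i \<subseteq> {i * k..<i * k + k}" by (auto simp: A_def)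
    ultimately show ?thesis using card_inj_on_le[of h "A i" "{i * k..<i * k + k}"] by simp
  qed
  moreover have "P = (\<Union>i<3. A i)"
  proof
    show "P \<subseteq> (\<Union>i<3. A i)"
    proof
      fix x assume x: "x \<in> P"
      then have "h x < 3 * k" using bij_betwE[OF h] assms(2) by fastforce
      then have "x \<in> A 0 \<or> x \<in> A 1 \<or> x \<in> A 2" using x by (auto simp: A_def)
      then show "x \<in> (\<Union>i<3. A i)" by force
    qed
  qed (auto simp: A_def)
  ultimately show ?thesis using that by blast
qed

text \<open>The nine sums of a part of P and a part of Q cover S, so one of them contains at least a
  ninth of S.\<close>

lemma sumset_pigeonhole:
  fixes P Q S :: "'a::ab_group_add set"
  assumes P: "finite P" "card P = n" and Q: "finite Q" "card Q = n" and "n \<ge> 2"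
    and S: "S \<subseteq> P + Q"
  obtains P' Q' S' where "finite P'" "finite Q'" "card P' + card Q' \<le> n"
    "S' \<subseteq> S" "S' \<subseteq> P' + Q'" "card S \<le> 9 * card S'"
proof -
  \<comment> \<open>The first inequality lets three blocks of size n div 2 cover n points, and fails
    for n = 1; the second keeps one part of P and one of Q within n points in total.\<close>
  have n: "n \<le> 3 * (n div 2)" "2 * (n div 2) \<le> n" using \<open>n \<ge> 2\<close> by linarith+
  obtain A :: "nat \<Rightarrow> 'a set" where A: "P = (\<Union>i<3. A i)" "\<And>i. card (A i) \<le> n div 2"
    using ex_three_part_cover[of P "n div 2"] P n by auto
  obtain B :: "nat \<Rightarrow> 'a set" where B: "Q = (\<Union>i<3. B i)" "\<And>i. card (B i) \<le> n div 2"
    using ex_three_part_cover[of Q "n div 2"] Q n by auto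
  let ?I = "{..<3::nat} \<times> {..<3::nat}"
  define T where "T k = S \<inter> (A (fst k) + B (snd k))" for k :: "nat \<times> nat"
  have "S \<subseteq> (\<Union>k\<in>?I. T k)"
  proof
    fix s assume "s \<in> S"
    then obtain p q where "s = p + q" "p \<in> P" "q \<in> Q" using S by (blast elim: set_plus_elim)
    then obtain i j where "i < 3" "j < 3" "p \<in> A i" "q \<in> B j" using A(1) B(1) by blast
    then show "s \<in> (\<Union>k\<in>?I. T k)"
      using \<open>s \<in> S\<close> \<open>s = p + q\<close> by (auto simp: T_def intro!: bexI[of _ "(i, j)"])
  qed
  moreover have "finite S" using finite_set_plus_card(1)[OF P(1) Q(1)] S finite_subset by blast
  ultimately have "card S \<le> card (\<Union>k\<in>?I. T k)" by (intro card_mono) (auto simp: T_def)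
  also have "\<dots> \<le> (\<Sum>k\<in>?I. card (T k))" by (intro card_UN_le) auto
  finally have sum: "card S \<le> (\<Sum>k\<in>?I. card (T k))" .
  have "\<exists>k\<in>?I. card S \<le> 9 * card (T k)"
  proof (rule ccontr)
    assume "\<not> ?thesis"
    then have "9 * card (T k) < card S" if "k \<in> ?I" for k using that not_le by blast
    then have "(\<Sum>k\<in>?I. 9 * card (T k)) < of_nat (card ?I) * card S"
      by (intro sum_bounded_above_strict) auto
    then show False using sum by (simp add: sum_distrib_left[symmetric])
  qed
  then obtain k where k: "k \<in> ?I" "card S \<le> 9 * card (T k)" by blast
  show ?thesis
  proof (rule that)
    show "finite (A (fst k))" using k(1) A(1) P(1) by (auto intro: finite_subset[of _ P])
    show "finite (B (snd k))" using k(1) B(1) Q(1) by (auto intro: finite_subset[of _ Q])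
    show "card (A (fst k)) + card (B (snd k)) \<le> n"
      using A(2)[of "fst k"] B(2)[of "snd k"] n by linarith
    show "T k \<subseteq> S" "T k \<subseteq> A (fst k) + B (snd k)" by (auto simp: T_def)
  qed (rule k(2))
qed

lemma M_fun_pigeonhole:
  fixes d :: "'d::finite itself"
  assumes "n \<ge> 2"
  obtains P Q S :: "(real ^ 'd) set" where "finite P" "finite Q" "card P + card Q \<le> n"
    "S \<subseteq> P + Q" "convexly_independent S" "M_fun d n n \<le> 9 * card S"
proof -
  obtain S P Q :: "(real ^ 'd) set" where S: "M_fun d n n = card S" "finite P" "card P = n"
      "finite Q" "card Q = n" "S \<subseteq> P + Q" "convexly_independent S"
    using M_fun_Max(1)[of d n n] by blast
  obtain P' Q' S' where "finite P'" "finite Q'" "card P' + card Q' \<le> n"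
      "S' \<subseteq> S" "S' \<subseteq> P' + Q'" "card S \<le> 9 * card S'"
    using sumset_pigeonhole[OF S(2-5) assms S(6)] by metis
  then show ?thesis using that convexly_independent_subset[OF S(7)] S(1) by metis
qed

section \<open>Lower bounds by the sumset problem\<close>

lemma M_fun_le_E_fun:
  fixes d :: "'d::finite itself"
  assumes "n \<ge> 2"
  shows "M_fun d n n \<le> 9 * E_fun d n"
proof -
  obtain P Q S :: "(real ^ 'd) set" where S: "finite P" "finite Q" "card P + card Q \<le> n"
    "S \<subseteq> P + Q" "convexly_independent S" "M_fun d n n \<le> 9 * card S"
    using M_fun_pigeonhole[OF assms, of d] by metis
  have "finite ((\<lambda>(p, q). p - q) ` (P \<times> Q))" using S by auto
  \<comment> \<open>Avoiding every difference \<open>p - q\<close> keeps the translate of Q disjoint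
    from P, so that each p and \<open>q + v\<close> form a genuine pair.\<close>
  then obtain v where v: "v \<notin> (\<lambda>(p, q). p - q) ` (P \<times> Q)"
    using infinite_UNIV_euclidean ex_new_if_finite by blast
  let ?R0 = "P \<union> (\<lambda>q. q + v) ` Q"
  have "card ?R0 \<le> card P + card Q"
    using card_Un_le[of P "(\<lambda>q. q + v) ` Q"] card_image_le[OF S(2), of "\<lambda>q. q + v"] by linarith
  then obtain R where R: "?R0 \<subseteq> R" "finite R" "card R = n"
    using ex_superset_card[of ?R0 n] S by auto
  have "\<forall>s\<in>S. \<exists>p q. s = p + q \<and> p \<in> P \<and> q \<in> Q" using S(4) by (blast elim: set_plus_elim)
  then obtain p q where pq: "\<And>s. s \<in> S \<Longrightarrow> s = p s + q s \<and> p s \<in> P \<and> q s \<in> Q" by metis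
  define e where "e s = {p s, q s + v}" for s
  have ne: "p s \<noteq> q s + v" if "s \<in> S" for s
    using v pq[OF that] by (force simp: algebra_simps)
  \<comment> \<open>On S the midpoint is an injective affine function of s, so it preserves convex
    independence.\<close>
  have mid: "pair_midpoint (e s) = (1/2) *\<^sub>R v + (1/2) *\<^sub>R s" if "s \<in> S" for s
  proof -
    have "p s + (q s + v) = v + s" using pq[OF that] by (metis add.assoc add.commute)
    then show ?thesis
      by (simp only: e_def pair_midpoint_doubleton[OF ne[OF that]] midpoint_def inverse_eq_divide
          scaleR_add_right[symmetric])
  qed
  \<comment> \<open>Injectivity of the composite gives both distinct pairs and distinct
    midpoints.\<close>
  have "inj_on (pair_midpoint \<circ> e) S"
    by (rule inj_onI) (simp add: mid)
  then have inj: "inj_on e S" "inj_on pair_midpoint (e ` S)"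
    by (auto intro: inj_on_imageI2 inj_on_imageI)
  have "pair_midpoint ` e ` S = (\<lambda>s. (1/2) *\<^sub>R v + (1/2) *\<^sub>R s) ` S"
    using mid by (simp add: image_image)
  then have ci: "convexly_independent (pair_midpoint ` e ` S)"
    using convexly_independent_affinity[OF S(5), of "1/2" "(1/2) *\<^sub>R v"] by simp
  have "e ` S \<subseteq> pairs R"
    using R(1) pq ne by (auto simp: e_def pairs_def)
  then have "card (e ` S) \<le> E_of R" using E_of_Max(2)[OF R(2) _ inj(2) ci] by blast
  also have "\<dots> \<le> E_fun d n" using E_fun_Max(2)[OF R(2,3)] by simp
  finally show ?thesis using S(6) card_image[OF inj(1)] by simp
qed

lemma M_fun_le_W_fun:
  fixes d :: "'d::finite itself"
  assumes "n \<ge> 2"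
  shows "M_fun d n n \<le> 18 * W_fun d n"
proof -
  obtain P Q S :: "(real ^ 'd) set" where S: "finite P" "finite Q" "card P + card Q \<le> n"
    "S \<subseteq> P + Q" "convexly_independent S" "M_fun d n n \<le> 9 * card S"
    using M_fun_pigeonhole[OF assms, of d] by metis
  have "finite S" using finite_set_plus_card(1)[OF S(1,2)] S(4) finite_subset by blast
  then obtain T t N where T: "T \<subseteq> S" "card S \<le> 2 * card T" "strictly_convex_norm N"
      "\<And>x. x \<in> T \<Longrightarrow> N (x - t) = 1"
      "\<And>x y. x \<in> T \<Longrightarrow> y \<in> T \<Longrightarrow> x - t \<noteq> - (y - t)"
    using half_on_translated_unit_sphere[OF _ S(5)] by metis
  have scale: "N (c *\<^sub>R y) = \<bar>c\<bar> * N y" for c y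
    using T(3) by (simp add: strictly_convex_norm_def is_norm_def)
  \<comment> \<open>Q is reflected in t/2, so that \<open>p - (t - q)\<close> equals
    \<open>p + q - t\<close>, a unit vector whenever \<open>p + q\<close> lies in T.\<close>
  let ?R0 = "P \<union> (\<lambda>q. t - q) ` Q"
  have "card ?R0 \<le> card P + card Q"
    using card_Un_le[of P "(\<lambda>q. t - q) ` Q"] card_image_le[OF S(2), of "\<lambda>q. t - q"] by linarith
  then obtain R where R: "?R0 \<subseteq> R" "finite R" "card R = n"
    using ex_superset_card[of ?R0 n] S by auto
  have "\<forall>s\<in>T. \<exists>p q. s = p + q \<and> p \<in> P \<and> q \<in> Q"
    using S(4) T(1) by (blast elim: set_plus_elim)
  then obtain p q where pq: "\<And>s. s \<in> T \<Longrightarrow> s = p s + q s \<and> p s \<in> P \<and> q s \<in> Q" by metis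
  define e where "e s = {p s, t - q s}" for s
  have diff: "p s - (t - q s) = s - t" if "s \<in> T" for s
    using pq[OF that] by (metis add_diff_eq diff_diff_eq2)
  \<comment> \<open>Parallel unit vectors agree up to sign, and \<open>T(5)\<close> excludes
    opposite ones.\<close>
  have par: "s = s'" if *: "s \<in> T" "s' \<in> T" "parallel (e s) (e s')" for s s'
  proof -
    obtain x y u v c where xy: "e s = {x, y}" "e s' = {u, v}" "x - y = c *\<^sub>R (u - v)"
      using *(3) by (auto simp: parallel_def)
    \<comment> \<open>Endpoints are unordered, so \<open>parallel\<close> determines the difference
      vectors only up to sign; the factor absorbs it.\<close>
    have sign: "\<exists>c'. b = c' *\<^sub>R b'"
      if "a = b \<or> a = - b" "a' = b' \<or> a' = - b'" "a = c *\<^sub>R a'" for a b a' b' :: "real ^ 'd"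
    proof -
      have "b = c *\<^sub>R b' \<or> b = (- c) *\<^sub>R b'"
        using that by (auto simp: minus_equation_iff)
      then show ?thesis by blast
    qed
    have "x - y = s - t \<or> x - y = - (s - t)"
      using xy(1) diff[OF *(1)] by (auto simp: e_def doubleton_eq_iff algebra_simps)
    moreover have "u - v = s' - t \<or> u - v = - (s' - t)"
      using xy(2) diff[OF *(2)] by (auto simp: e_def doubleton_eq_iff algebra_simps)
    ultimately have "\<exists>c'. s - t = c' *\<^sub>R (s' - t)"
      using xy(3) by (rule sign)
    then obtain c' where c': "s - t = c' *\<^sub>R (s' - t)" by blast
    then have "\<bar>c'\<bar> = 1" using scale[of c' "s' - t"] T(4)[OF *(1)] T(4)[OF *(2)] by simp
    then have "c' = 1 \<or> c' = - 1" by auto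
    then show "s = s'" using c' T(5)[OF *(1,2)] by auto
  qed
  have "N (p s - (t - q s)) = 1" if "s \<in> T" for s using diff[OF that] T(4)[OF that] by metis
  moreover have "p s \<in> R" "t - q s \<in> R" if "s \<in> T" for s
    using R(1) pq[OF that] by auto
  ultimately have units: "e ` T \<subseteq> unit_segments N R"
    unfolding e_def unit_segments_def by blast
  have "N 0 = 0" using scale[of 0 0] by simp
  \<comment> \<open>By this reflexivity equal segments are parallel, so \<open>par\<close> also
    shows that e is injective.\<close>
  have "parallel (e s) (e s)" if "s \<in> T" for s
  proof -
    have "p s \<noteq> t - q s" using diff[OF that] T(4)[OF that] \<open>N 0 = 0\<close> by force
    then show ?thesis
      unfolding parallel_def e_def
      by (intro exI[of _ "p s"] exI[of _ "t - q s"] exI[of _ "p s"] exI[of _ "t - q s"] exI[of _ 1] conjI) auto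
  qed
  then have inj: "inj_on e T" by (intro inj_onI par) auto
  have "pairwise (\<lambda>e f. \<not> parallel e f) (e ` T)"
    using par by (auto simp: pairwise_def)
  then have "card (e ` T) \<le> W_fun d n"
    using W_fun_Max(2)[OF R(2,3) T(3) units] by simp
  then show ?thesis using S(6) T(2) card_image[OF inj] by simp
qed

section \<open>Combining the bounds\<close>

lemma asymptotically_equivalentI:
  assumes "\<And>n. n \<ge> 2 \<Longrightarrow> f n \<le> a * g n" "\<And>n. n \<ge> 2 \<Longrightarrow> g n \<le> b * f n" "a > 0" "b > 0"
  shows "asymptotically_equivalent f g"
  unfolding asymptotically_equivalent_def
proof (intro exI conjI allI impI)
  fix n :: nat assume "n \<ge> 2"
  then have "real (f n) \<le> real (a * g n)" "real (g n) \<le> real (b * f n)"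
    by (simp_all only: of_nat_le_iff assms(1,2))
  then show "1 / real a * real (f n) \<le> real (g n)" "real (g n) \<le> real b * real (f n)"
    using \<open>a > 0\<close> by (auto simp: field_simps)
qed (use assms in auto)

theorem proposition4:
  fixes d :: "'d::finite itself"
  shows "asymptotically_equivalent (\<lambda>n. M_fun d n n) (E_fun d)
       \<and> asymptotically_equivalent (E_fun d) (W_fun d)
       \<and> asymptotically_equivalent (\<lambda>n. M_fun d n n) (W_fun d)"
proof (intro conjI)
  show "asymptotically_equivalent (\<lambda>n. M_fun d n n) (E_fun d)"
    using E_fun_le_M_fun[of d] M_fun_le_E_fun[of _ d]
    by (intro asymptotically_equivalentI[of _ 9 _ 1]) auto
  show "asymptotically_equivalent (\<lambda>n. M_fun d n n) (W_fun d)"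
    using W_fun_le_M_fun[of d] M_fun_le_W_fun[of _ d]
    by (intro asymptotically_equivalentI[of _ 18 _ 1]) auto
  show "asymptotically_equivalent (E_fun d) (W_fun d)"
  \<comment> \<open>Both comparisons pass through M(n, n), so the factors 18 and 9 are those of the
    lower bounds.\<close>
  proof (rule asymptotically_equivalentI)
    fix n :: nat assume "n \<ge> 2"
    show "E_fun d n \<le> 18 * W_fun d n"
      using E_fun_le_M_fun[of d n] M_fun_le_W_fun[OF \<open>n \<ge> 2\<close>, of d] by linarith
    show "W_fun d n \<le> 9 * E_fun d n"
      using W_fun_le_M_fun[of d n] M_fun_le_E_fun[OF \<open>n \<ge> 2\<close>, of d] by linarith
  qed auto
qed

end
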